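(* Let $X$ be a non-reflexive Banach space and let $Y$ be a proper closed subspace of $X$. If $Y$ is both an M-ideal in $X$ and an almost isometric ideal in $X$, then $Y$ is almost square (ASQ).
   Context: All Banach spaces are real. $S_X$ and $B_X$ denote the unit sphere and closed unit ball of $X$. A Banach space $X$ is almost square (ASQ) if for every finite subset $(x_i)_{i=1}^N \subset S_X$ there exists a sequence $(y_n)\subset B_X$ such that $\|x_i\pm y_n\|\to 1$ for every $i=1,\ldots,N$ and $\|y_n\|\to 1$. A subspace $Y$ of $X$ is an M-ideal in $X$ if there is a norm one projection $P$ on $X^*$ whose kernel is the annihilator $Y^\perp$ and which satisfies $\|x^*\|=\|Px^*\|+\|x^*-Px^*\|$ for all $x^*\in X^*$. A subspace $Y$ of $X$ is an almost isometric ideal in $X$ if for every finite dimensional subspace $E$ of $X$ and every $\varepsilon>0$ there is a linear operator $u:E\to Y$ such that $u(e)=e$ for all $e\in E\cap Y$ and $(1+\varepsilon)^{-1}\|e\|\le\|u(e)\|\le(1+\varepsilon)\|e\|$ for all $e\in E$. *)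

theory Defs
  imports "HOL-Analysis.Analysis"
begin

text \<open>
  The ambient Banach space is a type \<open>'a\<close>, its subspaces are sets \<open>Y :: 'a set\<close> carrying the
  induced norm, and its dual is the type \<open>'a \<Rightarrow>\<^sub>L real\<close> with the operator norm.
\<close>

lift_definition bidual_embedding :: "'a::real_normed_vector \<Rightarrow> (('a \<Rightarrow>\<^sub>L real) \<Rightarrow>\<^sub>L real)"
  is "\<lambda>x f. blinfun_apply f x"
  by (rule blinfun.bounded_linear_left)

definition reflexive_space :: "'a::real_normed_vector itself \<Rightarrow> bool" where
  "reflexive_space _ \<longleftrightarrow> surj (bidual_embedding :: 'a \<Rightarrow> (('a \<Rightarrow>\<^sub>L real) \<Rightarrow>\<^sub>L real))"

definition annihilator :: "'a::real_normed_vector set \<Rightarrow> ('a \<Rightarrow>\<^sub>L real) set" where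
  "annihilator Y = {f. \<forall>y\<in>Y. blinfun_apply f y = 0}"

definition M_ideal :: "'a::real_normed_vector set \<Rightarrow> bool" where
  "M_ideal Y \<longleftrightarrow> subspace Y \<and>
     (\<exists>P :: ('a \<Rightarrow>\<^sub>L real) \<Rightarrow>\<^sub>L ('a \<Rightarrow>\<^sub>L real).
        P o\<^sub>L P = P \<and> norm P = 1 \<and>
        {f. blinfun_apply P f = 0} = annihilator Y \<and>
        (\<forall>f. norm f = norm (blinfun_apply P f) + norm (f - blinfun_apply P f)))"

text \<open>
  An operator on \<open>E\<close> is a function on \<open>'a\<close> of which only the values on \<open>E\<close> matter; linearity is
  therefore required on \<open>E\<close> only.
\<close>

definition almost_isometric_ideal :: "'a::real_normed_vector set \<Rightarrow> bool" where
  "almost_isometric_ideal Y \<longleftrightarrow> subspace Y \<and>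
     (\<forall>E (\<epsilon>::real). subspace E \<and> (\<exists>B. finite B \<and> E = span B) \<and> \<epsilon> > 0 \<longrightarrow>
        (\<exists>u :: 'a \<Rightarrow> 'a.
           (\<forall>e\<in>E. u e \<in> Y) \<and>
           (\<forall>e\<in>E. \<forall>e'\<in>E. u (e + e') = u e + u e') \<and>
           (\<forall>c. \<forall>e\<in>E. u (c *\<^sub>R e) = c *\<^sub>R u e) \<and>
           (\<forall>e\<in>E \<inter> Y. u e = e) \<and>
           (\<forall>e\<in>E. inverse (1 + \<epsilon>) * norm e \<le> norm (u e) \<and> norm (u e) \<le> (1 + \<epsilon>) * norm e)))"

text \<open>
  Almost squareness of the subspace \<open>Y\<close> as a normed space in its own right. The finite set may be
  empty; this only excludes the trivial space.
\<close>

definition almost_square :: "'a::real_normed_vector set \<Rightarrow> bool" where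
  "almost_square Y \<longleftrightarrow>
     (\<forall>F. finite F \<and> F \<subseteq> Y \<inter> sphere 0 1 \<longrightarrow>
        (\<exists>y :: nat \<Rightarrow> 'a.
           (\<forall>n. y n \<in> Y \<inter> cball 0 1) \<and>
           (\<forall>x\<in>F. (\<lambda>n. norm (x + y n)) \<longlonglongrightarrow> 1 \<and> (\<lambda>n. norm (x - y n)) \<longlonglongrightarrow> 1) \<and>
           (\<lambda>n. norm (y n)) \<longlonglongrightarrow> 1))"

end

(*
  An M-ideal Y has the n-ball property: for x in the unit ball of X and finitely many c_i in the
  unit ball of Y there is y in Y with all norms of x + c_i - y at most 1 + e.  Otherwise a
  Hahn-Banach functional (f_i) of norm at most 1 on the n-fold sup-sum of X annihilates the diagonal
  of Y and exceeds 1 at (x + c_i).  But then the sum of the f_i annihilates Y, so that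
  sum f_i(x + c_i) = sum (P f_i)(c_i) + sum (f_i - P f_i)(x), which the L-decomposition of the
  norms of the f_i bounds by 1.

  If x is a Riesz almost-orthogonal vector for the proper closed subspace Y and the c_i are plus and
  minus the given unit vectors together with 0, then z = x - y is almost of norm 1 and
  plus or minus x_i plus z almost lies in the unit ball of X.  An almost isometric ideal operator
  moves z into Y while fixing the x_i.
*)

theory Submission
  imports Defs "HOL-Library.Function_Algebras"
begin

section \<open>A Hahn--Banach theorem\<close>

text \<open>
  The scalar multiplication is a parameter because function types carry no canonical instance of
  \<open>real_vector\<close>.
\<close>

locale real_linear_space = vector_space scl
  for scl :: "real \<Rightarrow> 'v::ab_group_add \<Rightarrow> 'v" (infixr "\<star>" 75)
begin

text \<open>Homogeneity is asked only as an inequality for positive factors, which is what infima of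
  sublinear functionals deliver directly. Applying it to \<open>1/c\<close> as well yields
  equality.\<close>

definition sublinear :: "('v \<Rightarrow> real) \<Rightarrow> bool" where
  "sublinear p \<longleftrightarrow>
     (\<forall>a b. p (a + b) \<le> p a + p b) \<and> (\<forall>c v. c > 0 \<longrightarrow> p (c \<star> v) \<le> c * p v)"

lemma sublinearI:
  assumes "\<And>a b. p (a + b) \<le> p a + p b" "\<And>c v. c > 0 \<Longrightarrow> p (c \<star> v) \<le> c * p v"
  shows "sublinear p"
  using assms by (simp add: sublinear_def)

lemma sublinear_add: "sublinear p \<Longrightarrow> p (a + b) \<le> p a + p b"
  by (simp add: sublinear_def)

lemma sublinear_zero:
  assumes "sublinear p"
  shows "p 0 = 0"
proof -
  \<comment> \<open>This bounds \<open>p 0\<close> above by 0; subadditivity at 0 bounds it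
    below.\<close>
  have "p ((1/2) \<star> 0) \<le> (1/2) * p 0"
    using assms unfolding sublinear_def by (meson half_gt_zero zero_less_one)
  moreover have "p (0 + 0) \<le> p 0 + p 0"
    using assms by (rule sublinear_add)
  ultimately show ?thesis by simp
qed

lemma sublinear_scale:
  assumes "sublinear p" "c \<ge> 0"
  shows "p (c \<star> v) = c * p v"
proof (cases "c = 0")
  case True
  then show ?thesis using sublinear_zero[OF assms(1)] by simp
next
  case False
  then have c: "c > 0" using assms by simp
  then have "p (c \<star> v) \<le> c * p v"
    using assms by (simp add: sublinear_def)
  moreover have "p ((1/c) \<star> (c \<star> v)) \<le> (1/c) * p (c \<star> v)"
    using assms c unfolding sublinear_def by (meson zero_less_divide_1_iff)
  then have "c * p v \<le> p (c \<star> v)"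
    using c by (simp add: field_simps)
  ultimately show ?thesis by simp
qed

lemma sublinear_minus:
  assumes "sublinear p"
  shows "- p (- v) \<le> p v"
  using sublinear_add[OF assms, of v "- v"] sublinear_zero[OF assms] by simp

section \<open>Minimal sublinear functionals and their linearity\<close>

text \<open>The witness is the largest sublinear minorant of \<open>p\<close> whose value at
  \<open>- w\<close> is at most \<open>- p w\<close>. Tilting serves twice: it forces a functional
  to attain \<open>p w\<close>, and it shows that a minimal sublinear functional is odd.\<close>

lemma sublinear_tilt:
  assumes p: "sublinear p"
  shows "\<exists>q. sublinear q \<and> q \<le> p \<and> q (- w) \<le> - p w"
proof -
  define q where "q v = (INF t\<in>{0..}. p (v + t \<star> w) - t * p w)" for v
  \<comment> \<open>A lower bound independent of \<open>t\<close>, so that the infimum defining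
    \<open>q\<close> is a genuine one.\<close>
  have lower: "- p (- v) \<le> p (v + t \<star> w) - t * p w" if "t \<ge> 0" for v t
  proof -
    have "p (t \<star> w) \<le> p (v + t \<star> w) + p (- v)"
      using sublinear_add[OF p, of "v + t \<star> w" "- v"] by (simp add: algebra_simps)
    then show ?thesis using sublinear_scale[OF p that] by simp
  qed
  have le: "q v \<le> p (v + t \<star> w) - t * p w" if "t \<ge> 0" for v t
    unfolding q_def using that lower by (intro cINF_lower bdd_belowI2[where m = "- p (- v)"]) auto
  have ge: "a \<le> q v" if "\<And>t. t \<ge> 0 \<Longrightarrow> a \<le> p (v + t \<star> w) - t * p w" for a v
    unfolding q_def using that by (intro cINF_greatest) auto
  have "sublinear q"
  proof (rule sublinearI)
    fix a b
    \<comment> \<open>The two infima are taken one after the other: over \<open>s\<close> for fixed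
      \<open>t\<close>, then over \<open>t\<close>. The parameter \<open>t + s\<close> is admissible
      for \<open>a + b\<close>.\<close>
    have "q (a + b) - (p (a + t \<star> w) - t * p w) \<le> q b" if t: "t \<ge> 0" for t
    proof (rule ge)
      fix s :: real assume s: "s \<ge> 0"
      have "q (a + b) \<le> p ((a + b) + (t + s) \<star> w) - (t + s) * p w"
        using s t by (intro le) auto
      also have "(a + b) + (t + s) \<star> w = (a + t \<star> w) + (b + s \<star> w)"
        by (simp add: scale_left_distrib)
      also have "p \<dots> \<le> p (a + t \<star> w) + p (b + s \<star> w)"
        by (rule sublinear_add[OF p])
      finally show "q (a + b) - (p (a + t \<star> w) - t * p w) \<le> p (b + s \<star> w) - s * p w"
        by (simp add: algebra_simps)
    qed
    then have "q (a + b) - q b \<le> q a"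
      by (intro ge) (simp add: algebra_simps)
    then show "q (a + b) \<le> q a + q b" by simp
  next
    fix c :: real and v assume c: "c > 0"
    have "q (c \<star> v) / c \<le> q v"
    proof (rule ge)
      fix t :: real assume t: "t \<ge> 0"
      have "q (c \<star> v) \<le> p (c \<star> v + (c * t) \<star> w) - (c * t) * p w"
        using c t by (intro le) auto
      also have "c \<star> v + (c * t) \<star> w = c \<star> (v + t \<star> w)"
        by (simp add: scale_right_distrib)
      also have "p \<dots> = c * p (v + t \<star> w)"
        using c by (intro sublinear_scale[OF p]) simp
      finally show "q (c \<star> v) / c \<le> p (v + t \<star> w) - t * p w"
        using c by (simp add: field_simps)
    qed
    then show "q (c \<star> v) \<le> c * q v"
      using c by (simp add: field_simps)
  qed
  moreover have "q \<le> p"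
    using le[of 0] by (intro le_funI) simp
  moreover have "q (- w) \<le> - p w"
    using le[of 1 "- w"] sublinear_zero[OF p] by simp
  ultimately show ?thesis by blast
qed

text \<open>The pointwise infimum works: of two members of the chain one lies below both, and its
  subadditivity passes to the infimum. The common majorant \<open>p\<close> keeps the infimum
  finite, as \<open>q v\<close> is at least \<open>- q (- v)\<close> and hence at least
  \<open>- p (- v)\<close>.\<close>

lemma sublinear_Inf_chain:
  assumes C: "\<And>q. q \<in> C \<Longrightarrow> sublinear q \<and> q \<le> p" "C \<noteq> {}"
    and chain: "\<And>q r. q \<in> C \<Longrightarrow> r \<in> C \<Longrightarrow> q \<le> r \<or> r \<le> q"
  shows "\<exists>r. sublinear r \<and> (\<forall>q\<in>C. r \<le> q)"
proof -
  define r where "r v = (INF q\<in>C. q v)" for v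
  have lower: "- p (- v) \<le> q v" if "q \<in> C" for q v
    using sublinear_minus[of q v] C(1)[OF that] by (smt (verit) le_funD)
  have le: "r v \<le> q v" if "q \<in> C" for q v
    unfolding r_def using that lower by (intro cINF_lower bdd_belowI2[where m = "- p (- v)"]) auto
  have ge: "a \<le> r v" if "\<And>q. q \<in> C \<Longrightarrow> a \<le> q v" for a v
    unfolding r_def using that C(2) by (intro cINF_greatest) auto
  have "sublinear r"
  proof (rule sublinearI)
    fix a b
    have "r (a + b) - q1 a \<le> r b" if q1: "q1 \<in> C" for q1
    proof (rule ge)
      fix q2 assume q2: "q2 \<in> C"
      obtain q where q: "q \<in> C" "q \<le> q1" "q \<le> q2"
        using chain[OF q1 q2] q1 q2 by blast
      have "r (a + b) \<le> q (a + b)" using q by (intro le)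
      also have "\<dots> \<le> q a + q b" using C(1)[OF q(1)] by (intro sublinear_add) auto
      also have "\<dots> \<le> q1 a + q2 b" using q by (intro add_mono) (auto dest: le_funD)
      finally show "r (a + b) - q1 a \<le> q2 b" by simp
    qed
    then have "r (a + b) - r b \<le> r a"
      by (intro ge) (simp add: algebra_simps)
    then show "r (a + b) \<le> r a + r b" by simp
  next
    fix c :: real and v assume c: "c > 0"
    have "r (c \<star> v) / c \<le> r v"
    proof (rule ge)
      fix q assume q: "q \<in> C"
      have "r (c \<star> v) \<le> q (c \<star> v)" using q by (intro le)
      also have "\<dots> \<le> c * q v" using C(1)[OF q] c by (simp add: sublinear_def)
      finally show "r (c \<star> v) / c \<le> q v"
        using c by (simp add: field_simps)
    qed
    then show "r (c \<star> v) \<le> c * r v"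
      using c by (simp add: field_simps)
  qed
  then show ?thesis using le by (auto intro!: le_funI)
qed

text \<open>Zorn's lemma for the reversed pointwise order on the sublinear minorants of
  \<open>p\<close>; the empty chain is bounded by \<open>p\<close> itself.\<close>

lemma sublinear_minimal:
  assumes "sublinear p"
  shows "\<exists>q. sublinear q \<and> q \<le> p \<and> (\<forall>r. sublinear r \<and> r \<le> q \<longrightarrow> r = q)"
proof -
  define A where "A = {q. sublinear q \<and> q \<le> p}"
  have "\<exists>m\<in>A. \<forall>a\<in>A. m \<ge> a \<longrightarrow> a = m"
  proof (rule predicate_Zorn)
    show "partial_order_on A (relation_of (\<lambda>x y. x \<ge> y) A)"
      by (rule partial_order_on_relation_ofI) auto
  next
    fix C assume C: "C \<in> Chains (relation_of (\<lambda>x y. x \<ge> y) A)"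
    then have chain: "q \<le> r \<or> r \<le> q" if "q \<in> C" "r \<in> C" for q r
      using that by (auto simp: Chains_def relation_of_def)
    have CA: "C \<subseteq> A"
      using C by (auto simp: Chains_def relation_of_def)
    show "\<exists>u\<in>A. \<forall>a\<in>C. a \<ge> u"
    proof (cases "C = {}")
      case True
      then show ?thesis using assms by (auto simp: A_def)
    next
      case False
      then obtain q where q: "q \<in> C" by blast
      obtain r where r: "sublinear r" "\<forall>q\<in>C. r \<le> q"
        using sublinear_Inf_chain[of C p] CA False chain unfolding A_def by blast
      moreover have "r \<le> p"
        using r q CA unfolding A_def by (blast intro: order_trans)
      ultimately show ?thesis unfolding A_def by blast
    qed
  qed
  then show ?thesis unfolding A_def by (blast intro: order_trans)
qed

text \<open>No functional is extended from a subspace. Instead \<open>p\<close> is tilted at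
  \<open>w\<close> and a minimal sublinear functional is taken below the result; minimality makes it
  odd, and an odd sublinear functional is linear.\<close>

theorem Hahn_Banach_sublinear:
  assumes p: "sublinear p"
  obtains f where "\<And>a b. f (a + b) = f a + f b" "\<And>c v. f (c \<star> v) = c * f v"
    "\<And>v. f v \<le> p v" "f w = p w"
proof -
  obtain p' where p': "sublinear p'" "p' \<le> p" "p' (- w) \<le> - p w"
    using sublinear_tilt[OF p] by blast
  obtain f where f: "sublinear f" "f \<le> p'"
    and min: "\<And>r. sublinear r \<Longrightarrow> r \<le> f \<Longrightarrow> r = f"
    using sublinear_minimal[OF p'(1)] by blast
  have minus: "f (- v) = - f v" for v
  proof -
    \<comment> \<open>Minimality forces the tilt of \<open>f\<close> at \<open>v\<close> to be
      \<open>f\<close> itself.\<close>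
    obtain q where "sublinear q" "q \<le> f" "q (- v) \<le> - f v"
      using sublinear_tilt[OF f(1)] by blast
    then have "f (- v) \<le> - f v" using min by metis
    then show ?thesis using sublinear_minus[OF f(1), of v] by simp
  qed
  have le: "f v \<le> p v" for v
    using f(2) p'(2) by (meson le_funD order_trans)
  \<comment> \<open>Every minorant of \<open>p'\<close> inherits the tilt at \<open>- w\<close>;
    with oddness it gives the missing inequality at \<open>w\<close>.\<close>
  have "f (- w) \<le> - p w"
    using f(2) p'(3) by (meson le_funD order_trans)
  then have "f w = p w" using le[of w] minus by simp
  moreover have "f (a + b) = f a + f b" for a b
    using sublinear_add[OF f(1), of a b] sublinear_add[OF f(1), of "- a" "- b"] minus[of a]
      minus[of b] minus[of "a + b"] by simp
  moreover have "f (c \<star> v) = c * f v" for c v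
  proof (cases "c \<ge> 0")
    case True
    then show ?thesis by (rule sublinear_scale[OF f(1)])
  next
    case False
    then have "f ((- c) \<star> v) = (- c) * f v"
      by (intro sublinear_scale[OF f(1)]) simp
    then show ?thesis using minus[of "c \<star> v"] by simp
  qed
  ultimately show ?thesis using le that by blast
qed

end

interpretation fun_space: real_linear_space "\<lambda>c (v :: 'i \<Rightarrow> 'a::real_vector) i. c *\<^sub>R v i"
  by unfold_locales (auto simp: fun_eq_iff algebra_simps)

section \<open>The \<open>n\<close>-ball property of M-ideals\<close>

lemma blinfun_almost_attains_norm:
  fixes h :: "'a::real_normed_vector \<Rightarrow>\<^sub>L real"
  assumes "e > 0"
  obtains a where "norm a \<le> 1" "blinfun_apply h a > norm h - e"
proof -
  have "\<exists>a. norm a \<le> 1 \<and> blinfun_apply h a > norm h - e"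
  proof (rule ccontr)
    assume "\<nexists>a. norm a \<le> 1 \<and> blinfun_apply h a > norm h - e"
    then have *: "blinfun_apply h a \<le> norm h - e" if "norm a \<le> 1" for a
      using that by force
    have "blinfun_apply h x \<le> (norm h - e) * norm x" for x
    proof (cases "x = 0")
      case False
      have "blinfun_apply h (x /\<^sub>R norm x) \<le> norm h - e"
        using False by (intro *) simp
      with False show ?thesis by (simp add: blinfun.scaleR_right field_simps)
    qed simp
    from this this[of "- x" for x] have "norm (blinfun_apply h x) \<le> (norm h - e) * norm x" for x
      by (simp add: blinfun.minus_right abs_le_iff)
    moreover have "0 \<le> norm h - e" using *[of 0] by simp
    ultimately have "norm h \<le> norm h - e" by (intro norm_blinfun_bound)
    with assms show False by simp
  qed
  then show ?thesis using that by blast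
qed

text \<open>A family supported on a finite set is the sum of its one-coordinate families. This
  splits a functional on the sup-sum into its coordinate functionals.\<close>

lemma additive_fun_eq_sum:
  fixes f :: "('i \<Rightarrow> 'a::real_vector) \<Rightarrow> real"
  assumes add: "\<And>a b. f (a + b) = f a + f b" and "finite S"
  shows "f (\<lambda>i. if i \<in> S then v i else 0) = (\<Sum>s\<in>S. f (\<lambda>i. if i = s then v s else 0))"
  using \<open>finite S\<close>
proof induction
  case empty
  have "f 0 = 0" using add[of 0 0] by simp
  then show ?case by (simp add: zero_fun_def)
next
  case (insert x F)
  have "(\<lambda>i. if i \<in> insert x F then v i else 0)
      = (\<lambda>i. if i = x then v x else 0) + (\<lambda>i. if i \<in> F then v i else 0)"
    using insert by (auto simp: fun_eq_iff)
  then show ?case using insert add by simp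
qed

text \<open>
  The functional \<open>g\<close> represents a Hahn--Banach functional on the sup-sum of copies of the space
  indexed by \<open>S\<close>, which attains the distance of \<open>v\<close> to the diagonal of \<open>Y\<close>.
\<close>

lemma diagonal_distance_functional:
  fixes Y :: "'a::real_normed_vector set" and v :: "'i \<Rightarrow> 'a"
  assumes Y: "subspace Y" and S: "finite S" "S \<noteq> {}"
    and far: "\<And>y. y \<in> Y \<Longrightarrow> \<exists>s\<in>S. norm (v s - y) \<ge> d"
  obtains g :: "'i \<Rightarrow> 'a \<Rightarrow>\<^sub>L real"
  where "(\<Sum>s\<in>S. norm (g s)) \<le> 1" "(\<Sum>s\<in>S. g s) \<in> annihilator Y"
    "(\<Sum>s\<in>S. blinfun_apply (g s) (v s)) \<ge> d"
proof -
  define m where "m u = Max ((\<lambda>s. norm (u s)) ` S)" for u :: "'i \<Rightarrow> 'a"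
  have m_ge: "norm (u s) \<le> m u" if "s \<in> S" for u s
    unfolding m_def using S that by auto
  have m_le: "m u \<le> b" if "\<And>s. s \<in> S \<Longrightarrow> norm (u s) \<le> b" for u b
    unfolding m_def using S that by auto
  have m_0: "0 \<le> m u" for u
    using S(2) m_ge norm_ge_zero by (meson all_not_in_conv order_trans)
  \<comment> \<open>The distance from \<open>u\<close> to the diagonal of \<open>Y\<close> in the
    sup norm over \<open>S\<close>: a seminorm that ignores coordinates outside
    \<open>S\<close>.\<close>
  define p where "p u = (INF y\<in>Y. m (\<lambda>s. u s - y))" for u
  have p_le: "p u \<le> b" if "y \<in> Y" "\<And>s. s \<in> S \<Longrightarrow> norm (u s - y) \<le> b" for u y b
  proof -
    have "p u \<le> m (\<lambda>s. u s - y)"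
      unfolding p_def using that m_0 by (intro cINF_lower bdd_belowI2[where m = 0]) auto
    also have "\<dots> \<le> b" using that by (intro m_le)
    finally show ?thesis .
  qed
  have Y0: "0 \<in> Y" using Y by (rule subspace_0)
  have p_ge: "a \<le> p u" if "\<And>y. y \<in> Y \<Longrightarrow> a \<le> m (\<lambda>s. u s - y)" for a u
    unfolding p_def using that Y0 by (intro cINF_greatest) auto
  have "fun_space.sublinear p"
  proof (rule fun_space.sublinearI)
    fix a b
    have "p (a + b) - m (\<lambda>s. a s - y) \<le> p b" if y: "y \<in> Y" for y
    proof (rule p_ge)
      fix z assume z: "z \<in> Y"
      have "p (a + b) \<le> m (\<lambda>s. a s - y) + m (\<lambda>s. b s - z)"
      proof (rule p_le)
        show "y + z \<in> Y" using Y y z by (rule subspace_add)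
        fix s assume s: "s \<in> S"
        have "norm ((a + b) s - (y + z)) \<le> norm (a s - y) + norm (b s - z)"
          by (simp add: norm_diff_triangle_ineq)
        also have "\<dots> \<le> m (\<lambda>s. a s - y) + m (\<lambda>s. b s - z)"
          using m_ge[OF s, of "\<lambda>s. a s - y"] m_ge[OF s, of "\<lambda>s. b s - z"] by simp
        finally show "norm ((a + b) s - (y + z)) \<le> \<dots>" .
      qed
      then show "p (a + b) - m (\<lambda>s. a s - y) \<le> m (\<lambda>s. b s - z)" by simp
    qed
    then have "p (a + b) - p b \<le> p a"
      by (intro p_ge) (simp add: algebra_simps)
    then show "p (a + b) \<le> p a + p b" by simp
  next
    fix c :: real and u :: "'i \<Rightarrow> 'a" assume c: "c > 0"
    have "p (\<lambda>i. c *\<^sub>R u i) / c \<le> p u"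
    proof (rule p_ge)
      fix y assume y: "y \<in> Y"
      have "p (\<lambda>i. c *\<^sub>R u i) \<le> c * m (\<lambda>s. u s - y)"
      proof (rule p_le)
        show "c *\<^sub>R y \<in> Y" using Y y by (rule subspace_scale)
        fix s assume "s \<in> S"
        then have "norm (u s - y) \<le> m (\<lambda>s. u s - y)"
          using m_ge[of s "\<lambda>s. u s - y"] by simp
        then show "norm (c *\<^sub>R u s - c *\<^sub>R y) \<le> c * m (\<lambda>s. u s - y)"
          using c by (simp flip: scaleR_diff_right)
      qed
      then show "p (\<lambda>i. c *\<^sub>R u i) / c \<le> m (\<lambda>s. u s - y)"
        using c by (simp add: field_simps)
    qed
    then show "p (\<lambda>i. c *\<^sub>R u i) \<le> c * p u"
      using c by (simp add: field_simps)
  qed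
  then obtain f where add: "\<And>a b. f (a + b) = f a + f b"
    and scale: "\<And>c u. f (\<lambda>i. c *\<^sub>R u i) = c * f u"
    and f_le: "\<And>u. f u \<le> p u" and fv: "f v = p v"
    using fun_space.Hahn_Banach_sublinear[of p v] by metis
  \<comment> \<open>Both \<open>u\<close> and its negative are at distance 0 from the diagonal.
    Hence \<open>f\<close> annihilates the diagonal and, for \<open>y = 0\<close>, does not see
    coordinates outside \<open>S\<close>.\<close>
  have f_eq_0: "f u = 0" if "y \<in> Y" "\<And>s. s \<in> S \<Longrightarrow> u s = y" for u y
  proof -
    have "f u \<le> 0"
      using that by (intro order_trans[OF f_le] p_le[where y = y]) auto
    moreover have "f (\<lambda>i. (-1) *\<^sub>R u i) \<le> 0"
      using that Y by (intro order_trans[OF f_le] p_le[where y = "- y"]) (auto simp: subspace_neg)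
    ultimately show ?thesis using scale[of "-1" u] by simp
  qed
  define k where "k s a = f (\<lambda>i. if i = s then a else 0)" for s a
  have k_add: "k s (a + b) = k s a + k s b" for s a b
    unfolding k_def add[symmetric] by (rule arg_cong[where f = f]) (auto simp: fun_eq_iff)
  have k_scale: "k s (c *\<^sub>R a) = c * k s a" for s c a
    unfolding k_def scale[symmetric] by (rule arg_cong[where f = f]) (auto simp: fun_eq_iff)
  have k_le: "k s a \<le> norm a" for s a
    unfolding k_def using Y0 by (intro order_trans[OF f_le] p_le[where y = 0]) auto
  have "\<bar>k s a\<bar> \<le> norm a" for s a
    using k_le[of s a] k_le[of s "- a"] k_scale[of s "-1" a] by simp
  then have k_bl: "bounded_linear (k s)" for s
    by (intro bounded_linear_intro[where K = 1]) (auto simp: k_add k_scale)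
  define g where "g s = Blinfun (k s)" for s
  have g: "blinfun_apply (g s) a = k s a" for s a
    by (simp add: g_def bounded_linear_Blinfun_apply[OF k_bl])
  have f_sum: "f u = (\<Sum>s\<in>S. blinfun_apply (g s) (u s))" for u
  proof -
    have "f u = f ((\<lambda>i. if i \<in> S then u i else 0) + (\<lambda>i. if i \<in> S then 0 else u i))"
      by (rule arg_cong[where f = f]) (auto simp: fun_eq_iff)
    also have "\<dots> = f (\<lambda>i. if i \<in> S then u i else 0)"
      using f_eq_0[of 0 "\<lambda>i. if i \<in> S then 0 else u i"] Y0 by (simp add: add)
    also have "\<dots> = (\<Sum>s\<in>S. k s (u s))"
      unfolding k_def by (rule additive_fun_eq_sum[OF add S(1)])
    finally show ?thesis by (simp add: g)
  qed
  \<comment> \<open>The dual of a sup-sum is an l1-sum: almost norming vectors for the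
    \<open>g s\<close> form one family in the unit ball, on which \<open>f\<close> is at most 1.
    Each coordinate gets an equal share of the error \<open>e\<close>.\<close>
  have "(\<Sum>s\<in>S. norm (g s)) \<le> 1"
  proof (rule field_le_epsilon)
    fix e :: real assume e: "e > 0"
    define e' where "e' = e / card S"
    have "e' > 0" using S e by (simp add: e'_def card_gt_0_iff)
    then have "\<forall>s. \<exists>a. norm a \<le> 1 \<and> norm (g s) - e' < blinfun_apply (g s) a"
      using blinfun_almost_attains_norm by metis
    then obtain a where a: "norm (a s) \<le> 1" "norm (g s) - e' < blinfun_apply (g s) (a s)" for s
      by metis
    have "(\<Sum>s\<in>S. norm (g s) - e') \<le> (\<Sum>s\<in>S. blinfun_apply (g s) (a s))"
      using a(2) by (intro sum_mono less_imp_le)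
    also have "\<dots> = f a" by (simp add: f_sum)
    also have "\<dots> \<le> 1"
      using a Y0 by (intro order_trans[OF f_le] p_le[where y = 0]) auto
    finally show "(\<Sum>s\<in>S. norm (g s)) \<le> 1 + e"
      using S by (simp add: sum_subtractf e'_def)
  qed
  \<comment> \<open>The sum of the \<open>g s\<close> at \<open>y\<close> is \<open>f\<close> at the
    constant family \<open>y\<close>, a point of the diagonal.\<close>
  moreover have "(\<Sum>s\<in>S. g s) \<in> annihilator Y"
    using f_eq_0[of _ "\<lambda>_. _"] by (auto simp: annihilator_def blinfun.sum_left f_sum)
  moreover have "d \<le> p v"
  proof (rule p_ge)
    fix y assume "y \<in> Y"
    then obtain s where "s \<in> S" "norm (v s - y) \<ge> d" using far by blast
    then show "d \<le> m (\<lambda>s. v s - y)" using m_ge[of s "\<lambda>s. v s - y"] by simp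
  qed
  ultimately show ?thesis
    using that[of g] by (simp flip: f_sum add: fv)
qed

section \<open>Applying the L-decomposition\<close>

lemma M_ideal_n_ball:
  fixes Y :: "'a::real_normed_vector set" and c :: "'i \<Rightarrow> 'a"
  assumes M: "M_ideal Y" and S: "finite S" "\<And>s. s \<in> S \<Longrightarrow> c s \<in> Y \<and> norm (c s) \<le> 1"
    and x: "norm x \<le> 1" and e: "e > 0"
  obtains y where "y \<in> Y" "\<And>s. s \<in> S \<Longrightarrow> norm (x + c s - y) \<le> 1 + e"
proof -
  from M obtain P :: "('a \<Rightarrow>\<^sub>L real) \<Rightarrow>\<^sub>L ('a \<Rightarrow>\<^sub>L real)" where Y: "subspace Y"
    and PP: "P o\<^sub>L P = P"
    and ker: "{f. blinfun_apply P f = 0} = annihilator Y"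
    and L: "\<And>f. norm f = norm (blinfun_apply P f) + norm (f - blinfun_apply P f)"
    unfolding M_ideal_def by blast
  have "\<exists>y\<in>Y. \<forall>s\<in>S. norm (x + c s - y) \<le> 1 + e"
  proof (rule ccontr)
    assume "\<not> (\<exists>y\<in>Y. \<forall>s\<in>S. norm (x + c s - y) \<le> 1 + e)"
    then have far: "\<exists>s\<in>S. norm (x + c s - y) \<ge> 1 + e" if "y \<in> Y" for y
      using that by (auto simp: not_le dest!: bspec intro: less_imp_le)
    \<comment> \<open>For empty \<open>S\<close> the point \<open>y = 0\<close> would already
      do.\<close>
    then have "S \<noteq> {}" using subspace_0[OF Y] by blast
    then obtain g :: "'i \<Rightarrow> 'a \<Rightarrow>\<^sub>L real" where g: "(\<Sum>s\<in>S. norm (g s)) \<le> 1"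
      and gY: "(\<Sum>s\<in>S. g s) \<in> annihilator Y"
      and ge: "(\<Sum>s\<in>S. blinfun_apply (g s) (x + c s)) \<ge> 1 + e"
      using diagonal_distance_functional[OF Y S(1) _ far] by blast
    have PY: "blinfun_apply P f = 0 \<longleftrightarrow> f \<in> annihilator Y" for f
      using ker by blast
    \<comment> \<open>Since \<open>P\<close> is idempotent, \<open>g s - P (g s)\<close> lies in its
      kernel, the annihilator of \<open>Y\<close>. So \<open>g s\<close> and \<open>P (g s)\<close>
      agree at \<open>c s\<close>.\<close>
    have "blinfun_apply P (g s - blinfun_apply P (g s)) = 0" for s
      using arg_cong[OF PP, of "\<lambda>Q. blinfun_apply Q (g s)"] by (simp add: blinfun.diff_right)
    then have on_Y: "blinfun_apply (g s) (c s) = blinfun_apply (blinfun_apply P (g s)) (c s)"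
      if "s \<in> S" for s
      using S(2)[OF that] by (auto simp: PY annihilator_def blinfun.diff_left)
    have P_sum: "(\<Sum>s\<in>S. blinfun_apply P (g s)) = 0"
      using gY by (simp add: PY flip: blinfun.sum_right)
    \<comment> \<open>The terms \<open>P (g s) x\<close> cancel in total, so \<open>g s\<close> may
      be replaced by \<open>g s - P (g s)\<close> at \<open>x\<close>. Then \<open>c s\<close> and
      \<open>x\<close> are tested against complementary summands of \<open>g s\<close>, whose norms
      add up to \<open>norm (g s)\<close>.\<close>
    have "(\<Sum>s\<in>S. blinfun_apply (blinfun_apply P (g s)) x) = 0"
      using P_sum by (simp flip: blinfun.sum_left)
    then have "(\<Sum>s\<in>S. blinfun_apply (g s) (x + c s))
        = (\<Sum>s\<in>S. blinfun_apply (blinfun_apply P (g s)) (c s)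
              + blinfun_apply (g s - blinfun_apply P (g s)) x)"
      using on_Y by (simp add: blinfun.add_right blinfun.diff_left sum.distrib sum_subtractf)
    also have "\<dots> \<le> (\<Sum>s\<in>S. norm (g s))"
    proof (rule sum_mono)
      fix s assume s: "s \<in> S"
      have bound: "blinfun_apply h a \<le> norm h" if "norm a \<le> 1" for h :: "'a \<Rightarrow>\<^sub>L real" and a
      proof -
        have "blinfun_apply h a \<le> norm h * norm a"
          using norm_blinfun[of h a] by simp
        also have "\<dots> \<le> norm h" using that by (simp add: mult_left_le)
        finally show ?thesis .
      qed
      show "blinfun_apply (blinfun_apply P (g s)) (c s)
          + blinfun_apply (g s - blinfun_apply P (g s)) x \<le> norm (g s)"
        unfolding L[of "g s"] using S(2)[OF s] x by (intro add_mono bound) auto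
    qed
    finally show False using g ge e by simp
  qed
  then show ?thesis using that by blast
qed

section \<open>Almost squareness\<close>

text \<open>Riesz's lemma: take a point \<open>w\<close> outside \<open>Y\<close>, at positive
  distance because \<open>Y\<close> is closed, subtract an almost nearest point of \<open>Y\<close>
  and normalise. For \<open>e\<close> at least 1 the vector 0 suffices.\<close>

lemma Riesz_almost_orthogonal:
  fixes Y :: "'a::real_normed_vector set"
  assumes Y: "subspace Y" "closed Y" "Y \<noteq> UNIV" and e: "e > 0"
  obtains x where "norm x \<le> 1" "\<And>y. y \<in> Y \<Longrightarrow> norm (x - y) \<ge> 1 - e"
proof (cases "e \<ge> 1")
  case True
  show ?thesis
    by (rule that[of 0]) (use True norm_ge_zero in \<open>auto intro: order_trans[of _ 0]\<close>)
next
  case False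
  obtain w where w: "w \<notin> Y" using Y by blast
  have Yne: "Y \<noteq> {}" using Y subspace_0 by blast
  define d where "d = infdist w Y"
  have d: "d > 0" unfolding d_def using Y w Yne by (intro infdist_pos_not_in_closed) auto
  have "d < d / (1 - e)" using False e d by (simp add: field_simps)
  then obtain y0 where y0: "y0 \<in> Y" "dist w y0 < d / (1 - e)"
    unfolding d_def infdist_notempty[OF Yne]
    by (subst (asm) cINF_less_iff) (use Yne in \<open>auto intro!: bdd_belowI2[where m = 0]\<close>)
  define n where "n = norm (w - y0)"
  have n: "n > 0" "(1 - e) * n \<le> d" using w y0 False e by (auto simp: n_def dist_norm field_simps)
  show ?thesis
  proof (rule that[of "(w - y0) /\<^sub>R n"])
    show "norm ((w - y0) /\<^sub>R n) \<le> 1" using n by (simp add: n_def)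
    fix y assume y: "y \<in> Y"
    \<comment> \<open>Undoing the normalisation turns the distance to \<open>y\<close> into a
      distance from \<open>w\<close> to a point of \<open>Y\<close>, divided by
      \<open>n\<close>.\<close>
    have "y0 + n *\<^sub>R y \<in> Y" using Y y y0 by (simp add: subspace_add subspace_scale)
    then have "d \<le> dist w (y0 + n *\<^sub>R y)" unfolding d_def by (rule infdist_le)
    also have "\<dots> = norm (n *\<^sub>R ((w - y0) /\<^sub>R n - y))"
      using n by (simp add: dist_norm algebra_simps)
    also have "\<dots> = n * norm ((w - y0) /\<^sub>R n - y)" using n by simp
    finally have "n * (1 - e) \<le> n * norm ((w - y0) /\<^sub>R n - y)" using n(2) by (simp add: mult.commute)
    then show "1 - e \<le> norm ((w - y0) /\<^sub>R n - y)" using n(1) by (rule mult_left_le_imp_le)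
  qed
qed

lemma M_ideal_almost_square_outside:
  fixes Y :: "'a::real_normed_vector set"
  assumes Y: "closed Y" "Y \<noteq> UNIV" "M_ideal Y"
    and F: "finite F" "F \<subseteq> Y \<inter> sphere 0 1" and e: "e > 0"
  obtains z where "1 - e \<le> norm z" "norm z \<le> 1 + e"
    "\<And>s. s \<in> F \<Longrightarrow> norm (s + z) \<le> 1 + e \<and> norm (s - z) \<le> 1 + e"
proof -
  have sub: "subspace Y" using Y by (simp add: M_ideal_def)
  obtain x where x: "norm x \<le> 1" "\<And>y. y \<in> Y \<Longrightarrow> norm (x - y) \<ge> 1 - e"
    using Riesz_almost_orthogonal[OF sub Y(1,2) e] by blast
  \<comment> \<open>The centre 0 controls the norm of \<open>x - y\<close> itself; the two signs
    control its sum and its difference with each \<open>s\<close>.\<close>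
  define S where "S = insert 0 (F \<union> uminus ` F)"
  have "finite S" using F by (simp add: S_def)
  moreover have "s \<in> Y \<and> norm s \<le> 1" if "s \<in> S" for s
    using that F sub by (auto simp: S_def subspace_0 subspace_neg)
  ultimately obtain y where y: "y \<in> Y" "\<And>s. s \<in> S \<Longrightarrow> norm (x + s - y) \<le> 1 + e"
    using M_ideal_n_ball[OF Y(3), of S "\<lambda>s. s"] x(1) e by metis
  show ?thesis
  proof (rule that[of "x - y"])
    show "norm (x - y) \<ge> 1 - e" using x y by blast
    show "norm (x - y) \<le> 1 + e" using y(2)[of 0] by (simp add: S_def)
    fix s assume s: "s \<in> F"
    then have "s \<in> S" "- s \<in> S" by (auto simp: S_def)
    then have "norm (x + s - y) \<le> 1 + e" "norm (x + (- s) - y) \<le> 1 + e"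
      using y(2) by blast+
    moreover have "norm (s - (x - y)) = norm (x + (- s) - y)"
      by (subst norm_minus_commute) (simp add: algebra_simps)
    ultimately show "norm (s + (x - y)) \<le> 1 + e \<and> norm (s - (x - y)) \<le> 1 + e"
      by (simp add: algebra_simps)
  qed
qed

section \<open>Transfer into the subspace and passage to the limit\<close>

text \<open>The image \<open>u z\<close> has norm at most \<open>q\<close>, the square of
  \<open>1 + e\<close>, so it is divided by \<open>q\<close> to land in the unit ball. This moves it
  by at most \<open>q - 1\<close>, and \<open>s + u z\<close> and \<open>s - u z\<close> have norm
  at most \<open>q\<close>, whence the bound \<open>2 * q - 1\<close>. In the lower bound one factor
  \<open>1 + e\<close> comes from \<open>u\<close> and two from the division.\<close>

lemma M_ideal_almost_square_inside:
  fixes Y :: "'a::real_normed_vector set"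
  assumes Y: "closed Y" "Y \<noteq> UNIV" "M_ideal Y" "almost_isometric_ideal Y"
    and F: "finite F" "F \<subseteq> Y \<inter> sphere 0 1" and e: "e > 0"
  obtains y where "y \<in> Y" "norm y \<le> 1" "(1 - e) / (1 + e) ^ 3 \<le> norm y"
    "\<And>s. s \<in> F \<Longrightarrow> norm (s + y) \<le> 2 * (1 + e)\<^sup>2 - 1 \<and> norm (s - y) \<le> 2 * (1 + e)\<^sup>2 - 1"
proof -
  obtain z where z: "1 - e \<le> norm z" "norm z \<le> 1 + e"
    "\<And>s. s \<in> F \<Longrightarrow> norm (s + z) \<le> 1 + e \<and> norm (s - z) \<le> 1 + e"
    using M_ideal_almost_square_outside[OF Y(1-3) F e] by blast
  \<comment> \<open>\<open>E\<close> contains \<open>z\<close> and all of \<open>F\<close>; since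
    \<open>F\<close> lies in \<open>Y\<close>, the operator fixes its elements.\<close>
  define E where "E = span (insert z F)"
  have sub: "subspace Y" using Y by (simp add: M_ideal_def)
  have "subspace E \<and> (\<exists>B. finite B \<and> E = span B) \<and> e > 0"
    using F e unfolding E_def by blast
  then have "\<exists>u. (\<forall>a\<in>E. u a \<in> Y) \<and> (\<forall>a\<in>E. \<forall>b\<in>E. u (a + b) = u a + u b) \<and>
      (\<forall>c. \<forall>a\<in>E. u (c *\<^sub>R a) = c *\<^sub>R u a) \<and> (\<forall>a\<in>E \<inter> Y. u a = a) \<and>
      (\<forall>a\<in>E. inverse (1 + e) * norm a \<le> norm (u a) \<and> norm (u a) \<le> (1 + e) * norm a)"
    by (rule Y(4)[unfolded almost_isometric_ideal_def, THEN conjunct2, THEN spec, THEN spec, THEN mp])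
  then obtain u where u: "\<forall>a\<in>E. u a \<in> Y" "\<forall>a\<in>E. \<forall>b\<in>E. u (a + b) = u a + u b"
    "\<forall>c. \<forall>a\<in>E. u (c *\<^sub>R a) = c *\<^sub>R u a" "\<forall>a\<in>E \<inter> Y. u a = a"
    "\<forall>a\<in>E. inverse (1 + e) * norm a \<le> norm (u a) \<and> norm (u a) \<le> (1 + e) * norm a"
    by (elim exE conjE)
  note uY = u(1)[rule_format] and add = u(2)[rule_format] and scale = u(3)[rule_format]
    and fix_Y = u(4)[rule_format, OF IntI] and norm_u = u(5)[rule_format]
  have E: "subspace E" "z \<in> E" "F \<subseteq> E" unfolding E_def by (auto simp: span_base)
  have bound: "norm (u a) \<le> (1 + e)\<^sup>2" if "a \<in> E" "norm a \<le> 1 + e" for a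
  proof -
    have "norm (u a) \<le> (1 + e) * (1 + e)"
      using that e by (intro order_trans[OF conjunct2[OF norm_u]] mult_left_mono) auto
    then show ?thesis by (simp add: power2_eq_square)
  qed
  define q where "q = (1 + e)\<^sup>2"
  have q: "q \<ge> 1" using e by (simp add: q_def one_le_power)
  define y where "y = u z /\<^sub>R q"
  have nz: "norm (u z) \<le> q" unfolding q_def using E z by (intro bound)
  have "norm (u z - y) = norm ((1 - 1/q) *\<^sub>R u z)"
    by (simp add: y_def algebra_simps divide_inverse)
  also have "\<dots> = (1 - 1/q) * norm (u z)" using q by simp
  also have "\<dots> \<le> (1 - 1/q) * q" using q nz by (intro mult_left_mono) auto
  also have "\<dots> = q - 1" using q by (simp add: field_simps)
  finally have uzy: "norm (u z - y) \<le> q - 1" .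
  show ?thesis
  proof (rule that[of y])
    show "y \<in> Y" using uY E sub by (simp add: y_def subspace_scale)
    show "norm y \<le> 1" using nz q by (simp add: y_def field_simps)
    have "(1 - e) / (1 + e) ^ 3 = inverse (1 + e) * (1 - e) / q"
      by (simp add: q_def power2_eq_square power3_eq_cube field_simps)
    also have "\<dots> \<le> inverse (1 + e) * norm z / q"
      using e q z by (intro divide_right_mono mult_left_mono) auto
    also have "\<dots> \<le> norm (u z) / q"
      using norm_u[OF E(2)] q by (intro divide_right_mono) auto
    also have "\<dots> = norm y" using q by (simp add: y_def field_simps)
    finally show "(1 - e) / (1 + e) ^ 3 \<le> norm y" .
    fix s assume s: "s \<in> F"
    then have sE: "s \<in> E" "s \<in> Y" using E F by auto
    have "u (s + z) = s + u z" using add[OF sE(1) E(2)] fix_Y[OF sE] by simp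
    then have plus: "norm (s + u z) \<le> q"
      using bound[of "s + z"] z(3)[OF s] sE E by (simp add: q_def subspace_add)
    \<comment> \<open>\<open>u\<close> is linear on \<open>E\<close> only, so its value at
      \<open>s - z\<close> is computed through \<open>s + (- z)\<close> within
      \<open>E\<close>.\<close>
    have "- z \<in> E" using E by (simp add: subspace_neg)
    then have "u (s - z) = s - u z"
      using add[OF sE(1), of "- z"] scale[OF E(2), of "-1"] fix_Y[OF sE] by simp
    then have minus: "norm (s - u z) \<le> q"
      using bound[of "s - z"] z(3)[OF s] sE E by (simp add: q_def subspace_diff)
    have "norm (s + y) \<le> norm (s + u z) + norm (u z - y)"
      using norm_triangle_ineq4[of "s + u z" "u z - y"] by simp
    moreover have "norm (s - y) \<le> norm (s - u z) + norm (u z - y)"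
      using norm_triangle_ineq[of "s - u z" "u z - y"] by simp
    ultimately show "norm (s + y) \<le> 2 * (1 + e)\<^sup>2 - 1 \<and> norm (s - y) \<le> 2 * (1 + e)\<^sup>2 - 1"
      using plus minus uzy by (simp flip: q_def)
  qed
qed

theorem theorem4p2:
  fixes Y :: "'a::banach set"
  assumes "\<not> reflexive_space TYPE('a)"
    and "subspace Y" and "closed Y" and "Y \<noteq> UNIV"
    and "M_ideal Y"
    and "almost_isometric_ideal Y"
  shows "almost_square Y"
  unfolding almost_square_def
proof (intro allI impI)
  fix F assume "finite F \<and> F \<subseteq> Y \<inter> sphere 0 1"
  then have F: "finite F" "F \<subseteq> Y \<inter> sphere 0 1" by auto
  \<comment> \<open>The successor keeps the denominator nonzero at \<open>n = 0\<close>.\<close>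
  define e where "e n = 1 / real (Suc n)" for n
  have "e n > 0" for n by (simp add: e_def)
  then have "\<forall>n. \<exists>y. y \<in> Y \<and> norm y \<le> 1 \<and> (1 - e n) / (1 + e n) ^ 3 \<le> norm y \<and>
      (\<forall>s\<in>F. norm (s + y) \<le> 2 * (1 + e n)\<^sup>2 - 1 \<and> norm (s - y) \<le> 2 * (1 + e n)\<^sup>2 - 1)"
    using M_ideal_almost_square_inside[OF assms(3-6) F] by metis
  then obtain y where y: "\<And>n. y n \<in> Y" "\<And>n. norm (y n) \<le> 1"
    and y_ge: "\<And>n. (1 - e n) / (1 + e n) ^ 3 \<le> norm (y n)"
    and sum_le: "\<And>n s. s \<in> F \<Longrightarrow> norm (s + y n) \<le> 2 * (1 + e n)\<^sup>2 - 1"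
    and diff_le: "\<And>n s. s \<in> F \<Longrightarrow> norm (s - y n) \<le> 2 * (1 + e n)\<^sup>2 - 1"
    by metis
  have e: "e \<longlonglongrightarrow> 0"
    unfolding e_def using LIMSEQ_inverse_real_of_nat by (simp add: divide_inverse)
  have lim: "(\<lambda>n. (1 - e n) / (1 + e n) ^ 3) \<longlonglongrightarrow> 1"
    by (rule tendsto_eq_intros e refl | simp)+
  have "(\<lambda>n. norm (y n)) \<longlonglongrightarrow> 1"
    by (rule tendsto_sandwich[OF _ _ lim tendsto_const]) (use y y_ge in auto)
  moreover have "(\<lambda>n. norm (s + y n)) \<longlonglongrightarrow> 1 \<and> (\<lambda>n. norm (s - y n)) \<longlonglongrightarrow> 1" if s: "s \<in> F" for s
  proof -
    \<comment> \<open>As \<open>s\<close> is a unit vector, an upper bound near 1 for one of the two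
      norms is a lower bound near 1 for the other, so both are squeezed to 1.\<close>
    have two: "2 \<le> norm (s + y n) + norm (s - y n)" for n
    proof -
      have "norm s = 1" using s F by auto
      then have "2 = norm ((s + y n) + (s - y n))" by (simp flip: scaleR_2)
      also have "\<dots> \<le> norm (s + y n) + norm (s - y n)" by (rule norm_triangle_ineq)
      finally show ?thesis .
    qed
    have upper: "(\<lambda>n. 2 * (1 + e n)\<^sup>2 - 1) \<longlonglongrightarrow> 1"
      by (rule tendsto_eq_intros e refl | simp)+
    have lower: "(\<lambda>n. 2 - (2 * (1 + e n)\<^sup>2 - 1)) \<longlonglongrightarrow> 1"
      using tendsto_diff[OF tendsto_const[of 2] upper] by simp
    have ge: "2 - (2 * (1 + e n)\<^sup>2 - 1) \<le> norm (s + y n)"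
      "2 - (2 * (1 + e n)\<^sup>2 - 1) \<le> norm (s - y n)" for n
      using two[of n] sum_le[OF s, of n] diff_le[OF s, of n] by linarith+
    show ?thesis
      using tendsto_sandwich[OF _ _ lower upper] ge sum_le[OF s] diff_le[OF s] by auto
  qed
  ultimately show "\<exists>y :: nat \<Rightarrow> 'a. (\<forall>n. y n \<in> Y \<inter> cball 0 1) \<and>
      (\<forall>x\<in>F. (\<lambda>n. norm (x + y n)) \<longlonglongrightarrow> 1 \<and> (\<lambda>n. norm (x - y n)) \<longlonglongrightarrow> 1) \<and>
      (\<lambda>n. norm (y n)) \<longlonglongrightarrow> 1"
    using y by (intro exI[of _ y]) auto
qed

end
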